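(* Let $p$ be a prime number. If $B(x)\in\overline{\mathbb{Q}}[x]$ is a Belyi polynomial of degree less than $p$ such that $B(0)=0$, then $\operatorname{New}_p(B(x))\subset\operatorname{New}_p(B(x)-1)$ (as subsets of $\mathbb{R}^2$).
   Context: Fix a prime $p$, an algebraic closure $\overline{\mathbb{Q}}_p$ of the field $\mathbb{Q}_p$ of $p$-adic numbers, and an algebraic closure $\overline{\mathbb{Q}}$ of $\mathbb{Q}$ embedded in $\overline{\mathbb{Q}}_p$. Let $\nu_p:\overline{\mathbb{Q}}_p\to\mathbb{R}\cup\{\infty\}$ be the $p$-adic valuation, i.e. the extension to $\overline{\mathbb{Q}}_p$ of the usual $p$-adic valuation on $\mathbb{Q}$ (with $\nu_p(p)=1$ and $\nu_p(0)=\infty$). A (normalized) Belyi polynomial is a nonconstant polynomial $B(x)\in\overline{\mathbb{Q}}[x]$ such that $B(0),B(1)\in\{0,1\}$ and $\{B(x_i): B'(x_i)=0\}\subset\{0,1\}$. For a nonzero polynomial $f(x)=a_0+a_1x+\cdots+a_nx^n$ over $\overline{\mathbb{Q}}$, $\operatorname{Conv}_p(f)$ denotes the convex hull in $\mathbb{R}^2$ of the points $(i,\nu_p(a_i))$ with $a_i\neq 0$. The Newton polygon $\operatorname{New}_p(f(x))$ is the lower boundary of $\operatorname{Conv}_p(f)$: it is $\operatorname{Conv}_p(f)$ itself if that set is a point or a line segment; if $\operatorname{Conv}_p(f)$ is a polygon, it is the union of the segments $[v_0,v_1]\cup\cdots\cup[v_{m-1},v_m]$ joining consecutive vertices of the polygon,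 listed counter-clockwise from the left-most vertex $v_0$ to the right-most vertex $v_m$. *)

theory Defs
  imports "HOL-Analysis.Analysis" "HOL-Computational_Algebra.Computational_Algebra"
begin

definition rat_valuation :: "nat \<Rightarrow> rat \<Rightarrow> ereal" where
  "rat_valuation p r =
     (if r = 0 then \<infinity>
      else case quotient_of r of (a, b) \<Rightarrow>
        ereal (real (multiplicity (int p) a) - real (multiplicity (int p) b)))"

text \<open>
  Since \<open>p\<close> is a term, the field of \<open>p\<close>-adic numbers and its algebraic closure are not
  constructed as types but characterised up to isomorphism. The type \<open>'k\<close>, with the subfield
  \<open>Qp\<close> and the valuation \<open>v\<close>, is an algebraic closure of the \<open>p\<close>-adic field: \<open>v\<close> extends the
  \<open>p\<close>-adic valuation of the rationals, \<open>Qp\<close> is the completion of the rationals for \<open>v\<close>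
  (it is complete and the rationals are dense in it), and \<open>'k\<close> is algebraically closed and
  algebraic over \<open>Qp\<close>.
\<close>

locale padic_closure =
  fixes p :: nat
    and Qp :: "'k::{alg_closed_field,field_char_0} set"
    and v :: "'k \<Rightarrow> ereal"
  assumes v_not_MInf: "v x \<noteq> -\<infinity>"
    and v_eq_PInf_iff: "v x = \<infinity> \<longleftrightarrow> x = 0"
    and v_mult: "v (x * y) = v x + v y"
    and v_add: "min (v x) (v y) \<le> v (x + y)"
    and v_of_rat: "v (of_rat r) = rat_valuation p r"
    and Qp_one: "1 \<in> Qp"
    and Qp_diff: "x \<in> Qp \<Longrightarrow> y \<in> Qp \<Longrightarrow> x - y \<in> Qp"
    and Qp_mult: "x \<in> Qp \<Longrightarrow> y \<in> Qp \<Longrightarrow> x * y \<in> Qp"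
    and Qp_inverse: "x \<in> Qp \<Longrightarrow> inverse x \<in> Qp"
    and Qp_dense: "x \<in> Qp \<Longrightarrow> \<exists>r. ereal c < v (x - of_rat r)"
    and Qp_complete:
      "(\<forall>n. X n \<in> Qp) \<Longrightarrow> (\<forall>c. \<exists>N. \<forall>m\<ge>N. \<forall>n\<ge>N. ereal c < v (X m - X n)) \<Longrightarrow>
         \<exists>x\<in>Qp. (\<lambda>n. v (X n - x)) \<longlonglongrightarrow> \<infinity>"
    and algebraic_over_Qp: "\<exists>f. f \<noteq> 0 \<and> (\<forall>i. coeff f i \<in> Qp) \<and> poly f x = 0"

text \<open>
  The type \<open>'q\<close> is an algebraic closure of the rationals, embedded by \<open>emb\<close> into \<open>'k\<close>;
  a unital ring homomorphism between fields is injective.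
\<close>

locale embedded_rat_closure =
  fixes emb :: "'q::{alg_closed_field,field_char_0} \<Rightarrow> 'k::{alg_closed_field,field_char_0}"
  assumes algebraic_over_rat: "algebraic x"
    and emb_one: "emb 1 = 1"
    and emb_add: "emb (x + y) = emb x + emb y"
    and emb_mult: "emb (x * y) = emb x * emb y"

definition belyi_poly :: "'q::field_char_0 poly \<Rightarrow> bool" where
  "belyi_poly B \<longleftrightarrow>
     degree B > 0 \<and> poly B 0 \<in> {0, 1} \<and> poly B 1 \<in> {0, 1} \<and>
     {poly B x | x. poly (pderiv B) x = 0} \<subseteq> {0, 1}"

definition newton_hull :: "('q \<Rightarrow> ereal) \<Rightarrow> 'q::zero poly \<Rightarrow> (real \<times> real) set" where
  "newton_hull w f = convex hull {(real i, real_of_ereal (w (coeff f i))) | i. coeff f i \<noteq> 0}"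

text \<open>
  \<open>ccw_succ P u v\<close>: walking counter-clockwise along the boundary of the convex polygon \<open>P\<close>,
  the vertex following \<open>u\<close> is \<open>v\<close>. The cross product condition says that \<open>P\<close> lies to the left
  of the line directed from \<open>u\<close> to \<open>v\<close>.
\<close>

definition ccw_succ :: "(real \<times> real) set \<Rightarrow> real \<times> real \<Rightarrow> real \<times> real \<Rightarrow> bool" where
  "ccw_succ P u v \<longleftrightarrow>
     u extreme_point_of P \<and> v extreme_point_of P \<and> u \<noteq> v \<and>
     (\<forall>z\<in>P. fst (v - u) * snd (z - u) - snd (v - u) * fst (z - u) \<ge> 0)"

text \<open>
  Distinctness makes the list go around the polygon at most once. In the situation of interest
  the left-most and right-most points are unique, and so is the list.
\<close>

definition lower_vertices :: "(real \<times> real) set \<Rightarrow> (real \<times> real) list \<Rightarrow> bool" where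
  "lower_vertices P vs \<longleftrightarrow>
     vs \<noteq> [] \<and> distinct vs \<and> set vs \<subseteq> {u. u extreme_point_of P} \<and>
     (\<forall>i. Suc i < length vs \<longrightarrow> ccw_succ P (vs ! i) (vs ! Suc i)) \<and>
     (\<forall>z\<in>P. fst (hd vs) \<le> fst z \<and> fst z \<le> fst (last vs))"

definition lower_boundary :: "(real \<times> real) set \<Rightarrow> (real \<times> real) set" where
  "lower_boundary P =
     (if \<exists>a b. P = closed_segment a b then P
      else \<Union>{closed_segment (vs ! i) (vs ! Suc i) | vs i.
               lower_vertices P vs \<and> Suc i < length vs})"

definition newton_polygon :: "('q \<Rightarrow> ereal) \<Rightarrow> 'q::zero poly \<Rightarrow> (real \<times> real) set" where
  "newton_polygon w f = lower_boundary (newton_hull w f)"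

end

theory Submission
  imports Defs
begin

text \<open>
  Write \<open>B = \<Sum> a\<^sub>i x\<^sup>i\<close>, let \<open>m\<close> be the order of \<open>B\<close> at \<open>0\<close>, and let \<open>l\<close> be the minimum of
  \<open>\<nu>(a\<^sub>i) / i\<close>. On the open disc \<open>\<nu>(x) > - l\<close> the values of \<open>B\<close> have positive valuation, so the critical
  points of \<open>B\<close> in that disc are roots of \<open>B\<close>. As \<open>deg B < p\<close>, the Newton polygon of \<open>B'\<close> is that of \<open>B\<close>
  shifted by one, so \<open>B'\<close> has exactly one root fewer than \<open>B\<close> in the disc. Hence \<open>B\<close> has a single distinct
  root there, namely \<open>0\<close>, and the minimum \<open>l\<close> is attained at \<open>i = m\<close>. So no point \<open>(i, \<nu>(a\<^sub>i))\<close> lies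
  below the line through the origin and \<open>(m, \<nu>(a\<^sub>m))\<close>, and passing to \<open>B - 1\<close>, which adds the point
  \<open>(0, 0)\<close>, merely prolongs the polygon to the left by a segment of slope \<open>l\<close>.
\<close>

subsection \<open>Roots in a disc for a non-archimedean absolute value\<close>

text \<open>The multiplicative form \<open>exp (- v)\<close> of a valuation: it is real-valued even
  at zero, so an infinite valuation needs no separate arithmetic.\<close>

locale nonarch_abs =
  fixes N :: "'a::field \<Rightarrow> real"
  assumes N_nonneg: "N x \<ge> 0"
    and N_eq_0_iff [simp]: "N x = 0 \<longleftrightarrow> x = 0"
    and N_mult: "N (x * y) = N x * N y"
    and N_add: "N (x + y) \<le> max (N x) (N y)"
begin

lemma N_0 [simp]: "N 0 = 0"
  by simp

lemma N_pos: "x \<noteq> 0 \<Longrightarrow> N x > 0"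
  by (metis N_eq_0_iff N_nonneg less_le)

lemma N_1 [simp]: "N 1 = 1"
  by (metis N_eq_0_iff N_mult mult_cancel_left1 mult_1 zero_neq_one)

lemma N_power: "N (x ^ n) = N x ^ n"
  by (induction n) (auto simp: N_mult)

lemma N_uminus [simp]: "N (- x) = N x"
proof -
  have "N (- 1) ^ 2 = 1"
    using N_mult[of "- 1" "- 1"] by (simp add: power2_eq_square)
  hence "N (- 1) = 1"
    using N_nonneg[of "- 1"] by (simp add: power2_eq_1_iff)
  thus ?thesis
    using N_mult[of "- 1" x] by simp
qed

lemma N_add_less: "N x < c \<Longrightarrow> N y < c \<Longrightarrow> N (x + y) < c"
  using N_add[of x y] by simp

text \<open>As x = (x + y) - y, the ultrametric inequality bounds \<open>N x\<close> by the larger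
  of \<open>N (x + y)\<close> and \<open>N y\<close>, and the latter is too small.\<close>

lemma N_add_eq: "N y < N x \<Longrightarrow> N (x + y) = N x"
  using N_add[of x y] N_add[of "x + y" "- y"] by auto

lemma N_sum_le: "finite A \<Longrightarrow> 0 \<le> c \<Longrightarrow> (\<And>i. i \<in> A \<Longrightarrow> N (f i) \<le> c) \<Longrightarrow> N (sum f A) \<le> c"
proof (induction A rule: finite_induct)
  case (insert a A)
  then have "N (sum f A) \<le> c" "N (f a) \<le> c" by auto
  then show ?case using insert.hyps N_add[of "f a" "sum f A"] by auto
qed simp

lemma N_sum_less: "finite A \<Longrightarrow> 0 < c \<Longrightarrow> (\<And>i. i \<in> A \<Longrightarrow> N (f i) < c) \<Longrightarrow> N (sum f A) < c"
proof (induction A rule: finite_induct)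
  case (insert a A)
  then show ?case by (auto intro!: N_add_less)
qed simp

text \<open>
  The index \<open>e\<close> is where the Newton polygon of \<open>f\<close> first touches its supporting line of slope
  \<open>ln \<rho>\<close>; equivalently, it is the number of roots of \<open>f\<close> in the open disc of radius \<open>\<rho>\<close>.
\<close>

definition dominant :: "real \<Rightarrow> 'a poly \<Rightarrow> nat \<Rightarrow> bool" where
  "dominant \<rho> f e \<longleftrightarrow> coeff f e \<noteq> 0 \<and>
     (\<forall>i. N (coeff f i) * \<rho> ^ i \<le> N (coeff f e) * \<rho> ^ e) \<and>
     (\<forall>i<e. N (coeff f i) * \<rho> ^ i < N (coeff f e) * \<rho> ^ e)"

lemma dominant_unique: "dominant \<rho> f d \<Longrightarrow> dominant \<rho> f e \<Longrightarrow> d = e"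
  unfolding dominant_def by (metis linorder_neqE_nat not_less)

text \<open>As in Gauss's lemma: among the products contributing to coefficient
  \<open>d + e\<close>, the one with indices \<open>d\<close> and \<open>e\<close> is strictly
  largest, because any other splitting has a left index below \<open>d\<close> or a right index
  below \<open>e\<close>.\<close>

lemma dominant_mult:
  assumes "\<rho> > 0" "dominant \<rho> f d" "dominant \<rho> g e"
  shows "dominant \<rho> (f * g) (d + e)"
proof -
  define a where "a = (\<lambda>i. N (coeff f i) * \<rho> ^ i)"
  define b where "b = (\<lambda>i. N (coeff g i) * \<rho> ^ i)"
  define t where "t = (\<lambda>n i. coeff f i * coeff g (n - i))"
  have ab0: "a i \<ge> 0" "b i \<ge> 0" for i
    using assms(1) N_nonneg by (auto simp: a_def b_def)
  have a: "a i \<le> a d" "i < d \<Longrightarrow> a i < a d" for i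
    using assms(2) by (auto simp: dominant_def a_def)
  have b: "b i \<le> b e" "i < e \<Longrightarrow> b i < b e" for i
    using assms(3) by (auto simp: dominant_def b_def)
  have pos: "a d > 0" "b e > 0"
    using assms N_pos by (auto simp: dominant_def a_def b_def)
  have t: "N (t n i) = a i * b (n - i) / \<rho> ^ n" if "i \<le> n" for n i
  proof -
    have "\<rho> ^ n = \<rho> ^ i * \<rho> ^ (n - i)"
      using that by (simp flip: power_add)
    thus ?thesis
      using assms(1) by (simp add: t_def N_mult a_def b_def)
  qed
  have strict: "a i * b j < a d * b e" if "i < d \<or> j < e" for i j
    using that
  proof
    assume "i < d"
    hence "a i * b j \<le> a i * b e" "a i * b e < a d * b e"
      using a b ab0 pos by (auto intro!: mult_left_mono)
    thus ?thesis by linarith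
  next
    assume "j < e"
    hence "a i * b j \<le> a d * b j" "a d * b j < a d * b e"
      using a b ab0 pos by (auto intro!: mult_right_mono)
    thus ?thesis by linarith
  qed
  have fg: "coeff (f * g) n = sum (t n) {..n}" for n
    by (simp add: coeff_mult t_def)
  have less: "N (coeff (f * g) n) * \<rho> ^ n < a d * b e" if "n < d + e" for n
  proof -
    have "N (coeff (f * g) n) < a d * b e / \<rho> ^ n"
      unfolding fg
    proof (rule N_sum_less)
      fix i assume "i \<in> {..n}"
      then show "N (t n i) < a d * b e / \<rho> ^ n"
        using that assms(1) strict[of i "n - i"] by (force simp: t intro!: divide_strict_right_mono)
    qed (use pos assms(1) in auto)
    thus ?thesis using assms(1) by (simp add: field_simps)
  qed
  have le: "N (coeff (f * g) n) * \<rho> ^ n \<le> a d * b e" for n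
  proof -
    have "N (coeff (f * g) n) \<le> a d * b e / \<rho> ^ n"
      unfolding fg
    proof (rule N_sum_le)
      fix i assume "i \<in> {..n}"
      then show "N (t n i) \<le> a d * b e / \<rho> ^ n"
        using assms(1) a b ab0 by (auto simp: t intro!: divide_right_mono mult_mono)
    qed (use pos assms(1) in auto)
    thus ?thesis using assms(1) by (simp add: field_simps)
  qed
  have eq: "N (coeff (f * g) (d + e)) * \<rho> ^ (d + e) = a d * b e"
  proof -
    let ?n = "d + e"
    have "N (sum (t ?n) ({..?n} - {d})) < N (t ?n d)"
    proof (rule N_sum_less)
      show "0 < N (t ?n d)"
        using pos assms(1) by (simp add: t)
      fix i assume "i \<in> {..?n} - {d}"
      hence i: "i \<le> ?n" "i < d \<or> ?n - i < e" by auto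
      thus "N (t ?n i) < N (t ?n d)"
        using strict[OF i(2)] assms(1) by (simp add: t divide_strict_right_mono)
    qed auto
    moreover have "sum (t ?n) {..?n} = t ?n d + sum (t ?n) ({..?n} - {d})"
      by (simp add: sum.remove[of _ d])
    ultimately have "N (coeff (f * g) ?n) = N (t ?n d)"
      by (simp add: fg N_add_eq)
    thus ?thesis using assms(1) by (simp add: t)
  qed
  have "coeff (f * g) (d + e) \<noteq> 0"
    using eq pos by fastforce
  with le less eq show ?thesis
    by (auto simp: dominant_def)
qed

text \<open>When \<open>N r = \<rho>\<close> the two terms tie and the smaller index wins; this is
  why the disc being counted is open.\<close>

lemma dominant_linear:
  assumes "\<rho> > 0"
  shows "dominant \<rho> [:- r, 1:] (if N r < \<rho> then 1 else 0)"
proof -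
  have "N (coeff [:- r, 1:] i) * \<rho> ^ i = (if i = 0 then N r else if i = 1 then \<rho> else 0)" for i
    by (cases i; cases "i - 1") (auto simp: coeff_pCons split: nat.splits)
  moreover have "N r < \<rho> \<or> r \<noteq> 0"
    using assms N_eq_0_iff by fastforce
  ultimately show ?thesis
    using assms N_nonneg[of r] by (auto simp: dominant_def)
qed

lemma dominant_prod_roots:
  assumes "\<rho> > 0" "c \<noteq> 0"
  shows "dominant \<rho> (smult c (\<Prod>r\<in>#A. [:- r, 1:])) (size (filter_mset (\<lambda>r. N r < \<rho>) A))"
proof (induction A)
  case empty
  have "N (coeff [:c:] i) * \<rho> ^ i = (if i = 0 then N c else 0)" for i
    by (cases i) auto
  with assms N_nonneg[of c] show ?case by (auto simp: dominant_def)
next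
  case (add r A)
  have "dominant \<rho> ([:- r, 1:] * smult c (\<Prod>r\<in>#A. [:- r, 1:]))
          ((if N r < \<rho> then 1 else 0) + size (filter_mset (\<lambda>r. N r < \<rho>) A))"
    by (intro dominant_mult dominant_linear assms add.IH)
  thus ?case by (auto simp: mult_smult_right)
qed

end

section \<open>Counting roots through the dominant index\<close>

lemma proots_prod_roots: "proots (\<Prod>r\<in>#A. [:- r, 1:]) = (A :: 'a::idom multiset)"
proof (induction A)
  case (add r A)
  have "(\<Prod>r\<in>#A. [:- r, 1:]) \<noteq> (0 :: 'a poly)"
    by (auto simp: prod_mset_zero_iff)
  with add show ?case
    by (simp add: proots_mult del: mult_pCons_left)
qed simp

text \<open>Splitting into linear factors turns the index into a root count. With
  \<open>dominant_unique\<close> that count can be read off from the coefficients.\<close>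

lemma dominant_size_proots:
  fixes N :: "'a::alg_closed_field \<Rightarrow> real"
  assumes "nonarch_abs N" "\<rho> > 0" "f \<noteq> 0"
  shows "nonarch_abs.dominant N \<rho> f (size (filter_mset (\<lambda>r. N r < \<rho>) (proots f)))"
proof -
  interpret nonarch_abs N by fact
  obtain A where A: "f = smult (lead_coeff f) (\<Prod>r\<in>#A. [:- r, 1:])"
    using alg_closed_imp_factorization[OF assms(3)] by blast
  have "proots f = A"
    by (subst A) (use assms(3) in \<open>simp add: proots_prod_roots\<close>)
  thus ?thesis
    using dominant_prod_roots[OF assms(2), of "lead_coeff f" A] A assms(3) by simp
qed

text \<open>The hypotheses on \<open>\<rho>\<close> say that the line of slope
  \<open>ln \<rho>\<close> through the origin supports the Newton points and touches them;
  \<open>tame\<close> encodes the degree bound through its effect on differentiation.\<close>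

lemma belyi_coeff_order_0:
  fixes N :: "'a::{alg_closed_field,field_char_0} \<Rightarrow> real"
  assumes "nonarch_abs N" and belyi: "belyi_poly B" and B0: "poly B 0 = 0"
    and tame: "\<And>i. 0 < i \<Longrightarrow> i \<le> degree B \<Longrightarrow> N (of_nat i) = 1"
    and "\<rho> > 0" and le: "\<And>i. 0 < i \<Longrightarrow> N (coeff B i) * \<rho> ^ i \<le> 1"
    and "\<exists>i>0. N (coeff B i) * \<rho> ^ i = 1"
  shows "N (coeff B (order 0 B)) * \<rho> ^ order 0 B = 1"
proof -
  interpret nonarch_abs N by fact
  let ?D = "\<lambda>r. N r < \<rho>"
  have c0: "coeff B 0 = 0"
    using B0 by (simp add: poly_0_coeff_0)
  have deg: "degree B > 0"
    using belyi by (simp add: belyi_poly_def)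
  hence B: "B \<noteq> 0" and B': "pderiv B \<noteq> 0"
    by (auto simp: pderiv_eq_0_iff)
  define e where "e = (LEAST i. N (coeff B i) * \<rho> ^ i = 1)"
  have e: "N (coeff B e) * \<rho> ^ e = 1"
    unfolding e_def using assms(7) by (metis (mono_tags, lifting) LeastI)
  have e0: "e > 0"
    using e c0 by (cases "e = 0") auto
  have le': "N (coeff B i) * \<rho> ^ i \<le> 1" for i
    using le[of i] c0 by (cases "i = 0") auto
  have less: "N (coeff B i) * \<rho> ^ i < 1" if "i < e" for i
    using not_less_Least[OF that[unfolded e_def]] le'[of i] by simp
  have dom: "dominant \<rho> B e"
    using e le' less by (auto simp: dominant_def)
  have N_pderiv: "N (coeff (pderiv B) i) = N (coeff B (Suc i))" for i
  proof (cases "Suc i \<le> degree B")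
    case True
    then show ?thesis using tame[of "Suc i"] by (simp add: coeff_pderiv N_mult del: of_nat_Suc)
  qed (simp add: coeff_pderiv coeff_eq_0)
  \<comment> \<open>The index shift costs one factor \<open>\<rho>\<close>, so the common bound 1
    becomes \<open>1 / \<rho>\<close> and the dominant index drops to \<open>e - 1\<close>.\<close>
  have pd_le: "N (coeff (pderiv B) i) * \<rho> ^ i \<le> 1 / \<rho>" for i
    using le'[of "Suc i"] \<open>\<rho> > 0\<close> by (simp add: N_pderiv field_simps)
  have pd_less: "N (coeff (pderiv B) i) * \<rho> ^ i < 1 / \<rho>" if "i < e - 1" for i
    using less[of "Suc i"] that \<open>\<rho> > 0\<close> by (simp add: N_pderiv field_simps)
  have pd_eq: "N (coeff (pderiv B) (e - 1)) * \<rho> ^ (e - 1) = 1 / \<rho>"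
    using e e0 \<open>\<rho> > 0\<close> by (cases e) (auto simp: N_pderiv field_simps)
  have dom': "dominant \<rho> (pderiv B) (e - 1)"
    using pd_le pd_less pd_eq \<open>\<rho> > 0\<close> by (auto simp: dominant_def)
  have small: "N (poly B x) < 1" if "N x < \<rho>" for x
    unfolding poly_altdef
  proof (rule N_sum_less)
    fix i
    show "N (coeff B i * x ^ i) < 1"
    proof (cases "coeff B i = 0")
      case False
      with c0 have i: "i > 0" by (cases "i = 0") auto
      have "N (coeff B i) * N x ^ i < N (coeff B i) * \<rho> ^ i"
        using False i that N_pos N_nonneg by (auto intro!: mult_strict_left_mono power_strict_mono)
      with le'[of i] show ?thesis by (simp add: N_mult N_power)
    qed simp
  qed auto
  have crit: "poly B x = 0" if "N x < \<rho>" "poly (pderiv B) x = 0" for x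
  proof -
    have "poly B x \<in> {0, 1}"
      using belyi that(2) by (auto simp: belyi_poly_def)
    with small[OF that(1)] show ?thesis by auto
  qed
  define S where "S = {r. poly B r = 0 \<and> N r < \<rho>}"
  have finS: "finite S"
    using poly_roots_finite[OF B] by (auto simp: S_def intro: finite_subset)
  \<comment> \<open>In characteristic zero each root of \<open>B\<close> loses exactly one
    multiplicity in \<open>pderiv B\<close>; by \<open>crit\<close>, \<open>pderiv B\<close> has no
    other roots in the disc. So the difference counts each distinct root once.\<close>
  have "filter_mset ?D (proots B) = filter_mset ?D (proots (pderiv B)) + mset_set S"
  proof (rule multiset_eqI)
    fix r
    consider "r \<in> S" | "N r < \<rho>" "poly B r \<noteq> 0" | "\<not> N r < \<rho>"
      by (auto simp: S_def)
    then show "count (filter_mset ?D (proots B)) r =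
          count (filter_mset ?D (proots (pderiv B)) + mset_set S) r"
    proof cases
      case 1
      then show ?thesis
        using B B' finS order_pderiv[OF B, of r] by (auto simp: S_def)
    next
      case 2
      hence "poly (pderiv B) r \<noteq> 0" using crit by blast
      with 2 show ?thesis
        using B B' finS by (auto simp: S_def order_0I count_mset_set')
    next
      case 3
      then show ?thesis using finS by (auto simp: S_def count_mset_set')
    qed
  qed
  moreover have "size (filter_mset ?D (proots B)) = e"
    using dominant_unique[OF dom dominant_size_proots[OF assms(1) \<open>\<rho> > 0\<close> B]] by simp
  moreover have "size (filter_mset ?D (proots (pderiv B))) = e - 1"
    using dominant_unique[OF dom' dominant_size_proots[OF assms(1) \<open>\<rho> > 0\<close> B']] by simp
  ultimately have "e = e - 1 + card S"
    using finS by (metis size_union size_mset_set)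
  hence "card S = 1" using e0 by simp
  moreover have "0 \<in> S"
    using B0 \<open>\<rho> > 0\<close> by (auto simp: S_def)
  ultimately have S: "S = {0}" by (metis card_1_singletonE singletonD)
  \<comment> \<open>All \<open>e\<close> roots in the disc sit at 0, so \<open>e\<close> is the
    multiplicity of that root.\<close>
  have "filter_mset ?D (proots B) = replicate_mset (order 0 B) 0"
  proof (rule multiset_eqI)
    fix r
    have "order r B = 0" if "N r < \<rho>" "r \<noteq> 0"
      using that S order_0I[of B r] by (auto simp: S_def)
    thus "count (filter_mset ?D (proots B)) r = count (replicate_mset (order 0 B) 0) r"
      using B \<open>0 \<in> S\<close> by (auto simp: S_def)
  qed
  with \<open>size (filter_mset ?D (proots B)) = e\<close> have "order 0 B = e" by simp
  with e show ?thesis by simp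
qed

subsection \<open>The lower boundary after adjoining the origin\<close>

text \<open>A proper convex combination attains the minimum of \<open>h\<close> only if both
  endpoints do.\<close>

lemma extreme_point_of_unique_min:
  fixes h :: "'a::real_vector \<Rightarrow> real"
  assumes "linear h" "x \<in> P" "\<And>z. z \<in> P \<Longrightarrow> h x \<le> h z" "\<And>z. z \<in> P \<Longrightarrow> h z = h x \<Longrightarrow> z = x"
  shows "x extreme_point_of P"
  unfolding extreme_point_of_def
proof (intro conjI ballI notI)
  fix a b assume ab: "a \<in> P" "b \<in> P" "x \<in> open_segment a b"
  then obtain u where u: "0 < u" "u < 1" "x = (1 - u) *\<^sub>R a + u *\<^sub>R b" and "a \<noteq> b"
    by (auto simp: in_segment)
  have "h x = (1 - u) * h a + u * h b"
    using assms(1) u(3) by (simp add: linear_add linear_scale)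
  moreover have "(1 - u) * h x \<le> (1 - u) * h a" "u * h x \<le> u * h b"
    using u ab assms(3) by (auto intro!: mult_left_mono)
  ultimately have "(1 - u) * h a = (1 - u) * h x" "u * h b = u * h x"
    by (auto simp: algebra_simps)
  hence "a = x" "b = x"
    using u ab assms(4) by auto
  with \<open>a \<noteq> b\<close> show False by simp
qed fact

text \<open>Twice the signed area of the triangle \<open>a\<close>, \<open>b\<close>,
  \<open>z\<close>, positive when \<open>z\<close> lies to the left of the line from
  \<open>a\<close> to \<open>b\<close>.\<close>

definition cross :: "real \<times> real \<Rightarrow> real \<times> real \<Rightarrow> real \<times> real \<Rightarrow> real" where
  "cross a b z = fst (b - a) * snd (z - a) - snd (b - a) * fst (z - a)"

lemma ccw_succ_cross:
  "ccw_succ P u v \<longleftrightarrow>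
     u extreme_point_of P \<and> v extreme_point_of P \<and> u \<noteq> v \<and> (\<forall>z\<in>P. cross u v z \<ge> 0)"
  by (simp add: ccw_succ_def cross_def)

text \<open>Models the hull \<open>P\<close> of the Newton points of \<open>B\<close>:
  \<open>A\<close> is the point at the order of vanishing, \<open>Z\<close> the one at the degree,
  and \<open>l\<close> the slope of the line from the origin to \<open>A\<close>.\<close>

locale cone_over =
  fixes P :: "(real \<times> real) set" and A Z :: "real \<times> real" and l :: real
  assumes convex_P: "convex P" and A: "A \<in> P" and Z: "Z \<in> P"
    and fst_A_pos: "fst A > 0"
    and left: "\<And>z. z \<in> P \<Longrightarrow> z \<noteq> A \<Longrightarrow> fst A < fst z"
    and right: "\<And>z. z \<in> P \<Longrightarrow> z \<noteq> Z \<Longrightarrow> fst z < fst Z"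
    and snd_A: "snd A = l * fst A"
    and above: "\<And>z. z \<in> P \<Longrightarrow> snd z \<ge> l * fst z"
begin

definition "Q = convex hull (insert 0 P)"

lemma P_subset_Q: "P \<subseteq> Q"
  unfolding Q_def by (meson hull_subset insert_subset)

lemma zero_in_Q: "0 \<in> Q"
  unfolding Q_def by (simp add: hull_inc)

lemma QE:
  assumes "z \<in> Q"
  obtains q s where "q \<in> P" "0 \<le> s" "s \<le> 1" "z = s *\<^sub>R q"
proof -
  have "convex hull P = P" "P \<noteq> {}"
    using convex_P A by (auto simp: hull_same)
  with assms have "z \<in> {(1 - u) *\<^sub>R 0 + u *\<^sub>R x |x u. 0 \<le> u \<and> u \<le> 1 \<and> x \<in> P}"
    unfolding Q_def convex_hull_insert_alt by simp
  with that show ?thesis by auto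
qed

lemma left': "z \<in> P \<Longrightarrow> fst A \<le> fst z"
  using left[of z] by fastforce

lemma right': "z \<in> P \<Longrightarrow> fst z \<le> fst Z"
  using right[of z] by fastforce

lemma fst_Q_nonneg: "z \<in> Q \<Longrightarrow> 0 \<le> fst z"
  using fst_A_pos left' by (fastforce elim!: QE)

lemma fst_Q_le: "z \<in> Q \<Longrightarrow> fst z \<le> fst Z"
proof (elim QE)
  fix q s assume *: "q \<in> P" "0 \<le> s" "s \<le> 1" "z = s *\<^sub>R q"
  then have "s * fst q \<le> 1 * fst q"
    using left'[of q] fst_A_pos by (intro mult_right_mono) auto
  with right'[of q] * show ?thesis by simp
qed

lemma above_Q: "z \<in> Q \<Longrightarrow> snd z \<ge> l * fst z"
  using above by (auto elim!: QE) (metis mult.left_commute mult_left_mono)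

lemma extreme_zero: "0 extreme_point_of Q"
proof (rule extreme_point_of_unique_min[where h = fst])
  fix z assume "z \<in> Q" "fst z = fst (0 :: real \<times> real)"
  moreover obtain q s where q: "q \<in> P" "z = s *\<^sub>R q"
    using QE[OF \<open>z \<in> Q\<close>] by metis
  moreover have "fst q > 0"
    using left'[OF q(1)] fst_A_pos by simp
  ultimately show "z = 0" by simp
qed (use fst_Q_nonneg zero_in_Q in \<open>auto simp: linear_fst\<close>)

text \<open>
  A supporting line of \<open>P\<close> with the origin strictly on the same side as \<open>P\<close> meets \<open>Q\<close> only in
  points of \<open>P\<close>.
\<close>

lemma extreme_point_supported:
  fixes c :: real
  assumes x: "x extreme_point_of P" and "linear h"
    and c: "\<And>z. z \<in> P \<Longrightarrow> h z \<ge> c" "h x = c" "c < 0"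
  shows "x extreme_point_of Q"
proof -
  have ge: "h z \<ge> c" if "z \<in> Q" for z
    using that
  proof (elim QE)
    fix q s assume *: "q \<in> P" "0 \<le> s" "s \<le> 1" "z = s *\<^sub>R q"
    \<comment> \<open>Since \<open>c < 0\<close>, scaling by \<open>s \<le> 1\<close> moves
      \<open>c\<close> up towards 0, so the bound survives on \<open>Q\<close>.\<close>
    have "s * c \<le> s * h q" "1 * c \<le> s * c"
      using * c(1)[of q] c(3) by (auto intro!: mult_left_mono mult_right_mono_neg)
    then show ?thesis using * assms(2) by (simp add: linear_scale)
  qed
  have mem: "z \<in> P" if "z \<in> Q" "h z = c" for z
    using that(1)
  proof (elim QE)
    fix q s assume *: "q \<in> P" "0 \<le> s" "s \<le> 1" "z = s *\<^sub>R q"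
    have "s * c \<le> s * h q"
      using * c(1)[of q] by (auto intro!: mult_left_mono)
    also have "\<dots> = c"
      using * that(2) assms(2) by (simp add: linear_scale)
    finally have "s \<ge> 1"
      using c(3) by (simp add: mult_le_cancel_right2)
    with * show ?thesis by auto
  qed
  show ?thesis
    unfolding extreme_point_of_def
  proof (intro conjI ballI notI)
    show "x \<in> Q" using x P_subset_Q by (auto simp: extreme_point_of_def)
    fix a b assume ab: "a \<in> Q" "b \<in> Q" "x \<in> open_segment a b"
    then obtain u where u: "0 < u" "u < 1" "x = (1 - u) *\<^sub>R a + u *\<^sub>R b"
      by (auto simp: in_segment)
    have "c = (1 - u) * h a + u * h b"
      using assms(2) u(3) c(2) by (simp add: linear_add linear_scale)
    moreover have "(1 - u) * c \<le> (1 - u) * h a" "u * c \<le> u * h b"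
      using u ab ge by (auto intro!: mult_left_mono)
    ultimately have "(1 - u) * h a = (1 - u) * c" "u * h b = u * c"
      by (auto simp: algebra_simps)
    hence "a \<in> P" "b \<in> P"
      using u ab mem by auto
    with x ab(3) show False by (auto simp: extreme_point_of_def)
  qed
qed

lemma extreme_point_Z: "Z extreme_point_of Q"
proof (rule extreme_point_supported[where h = "\<lambda>z. - fst z" and c = "- fst Z"])
  show "Z extreme_point_of P"
    using right right' Z
    by (intro extreme_point_of_unique_min[where h = "\<lambda>z. - fst z"])
       (force simp: linear_compose_neg linear_fst)+
  show "- fst Z < 0" using fst_A_pos left'[OF Z] by simp
qed (use right' in \<open>auto simp: linear_compose_neg linear_fst\<close>)

lemma cross_eq: "cross a b z = (fst (b - a) * snd z - snd (b - a) * fst z)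
    - (fst (b - a) * snd a - snd (b - a) * fst a)"
  by (simp add: cross_def algebra_simps)

lemma linear_cross0: "linear (\<lambda>z :: real \<times> real. r * snd z - t * fst z)"
  by (intro linearI) (auto simp: algebra_simps)

lemma extreme_point_cross:
  assumes "x extreme_point_of P" "\<And>z. z \<in> P \<Longrightarrow> cross a b z \<ge> 0" "cross a b x = 0" "cross a b 0 > 0"
  shows "x extreme_point_of Q"
  \<comment> \<open>The constant supplied here is \<open>- cross a b 0\<close>, so the hypothesis on
    the origin is exactly its negativity.\<close>
  by (rule extreme_point_supported[OF assms(1) linear_cross0[of "fst (b - a)" "snd (b - a)"],
        where c = "fst (b - a) * snd a - snd (b - a) * fst a"])
     (use assms in \<open>auto simp: cross_eq\<close>)

text \<open>\<open>cross a b\<close> is affine, so on the segment from the origin to a point of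
  \<open>P\<close> it interpolates between its values at the two ends.\<close>

lemma ccw_succ_Q:
  assumes "ccw_succ P a b" "cross a b 0 \<ge> 0" "a extreme_point_of Q" "b extreme_point_of Q"
  shows "ccw_succ Q a b"
  unfolding ccw_succ_cross
proof (intro conjI ballI)
  fix z assume "z \<in> Q"
  then obtain q s where q: "q \<in> P" "0 \<le> s" "s \<le> 1" "z = s *\<^sub>R q" by (elim QE)
  have "cross a b z = s * cross a b q + (1 - s) * cross a b 0"
    using q by (simp add: cross_def algebra_simps)
  also have "\<dots> \<ge> 0"
    using q assms by (auto simp: ccw_succ_cross)
  finally show "cross a b z \<ge> 0" .
qed (use assms in \<open>auto simp: ccw_succ_cross\<close>)

lemma ccw_succ_Q_zero:
  assumes "b extreme_point_of Q" "fst b > 0" "snd b = l * fst b"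
  shows "ccw_succ Q 0 b"
  unfolding ccw_succ_cross
proof (intro conjI ballI)
  fix z assume "z \<in> Q"
  from above_Q[OF this] assms(2) have "fst b * (snd z - l * fst z) \<ge> 0" by simp
  thus "cross 0 b z \<ge> 0" using assms(3) by (simp add: cross_def algebra_simps)
qed (use assms extreme_zero in auto)

section \<open>The vertex list of \<open>P\<close> viewed inside \<open>Q\<close>\<close>

context
  fixes vs assumes vs: "lower_vertices P vs"
begin

lemma vs_nth: "i < length vs \<Longrightarrow> vs ! i extreme_point_of P" "i < length vs \<Longrightarrow> vs ! i \<in> P"
  using vs by (auto simp: lower_vertices_def extreme_point_of_def dest!: nth_mem)

lemma vs_Cons: "vs \<noteq> []" "distinct vs" "hd vs = A" "last vs = Z" "vs ! 0 = A"
proof -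
  show ne: "vs \<noteq> []" and "distinct vs" using vs by (auto simp: lower_vertices_def)
  have "hd vs \<in> P" "last vs \<in> P"
    using vs_nth ne by (auto simp: hd_conv_nth last_conv_nth)
  moreover have "fst (hd vs) \<le> fst A" "fst Z \<le> fst (last vs)"
    using vs A Z by (auto simp: lower_vertices_def)
  ultimately show "hd vs = A" "last vs = Z"
    using left right by fastforce+
  with ne show "vs ! 0 = A" by (simp add: hd_conv_nth)
qed

lemma vs_succ: "Suc i < length vs \<Longrightarrow> ccw_succ P (vs ! i) (vs ! Suc i)"
  using vs by (auto simp: lower_vertices_def)

lemma vs_neq_Z: "Suc i < length vs \<Longrightarrow> vs ! i \<noteq> Z"
  using vs_Cons nth_eq_iff_index_eq[of vs i "length vs - 1"] by (auto simp: last_conv_nth)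

lemma vs_neq_A: "0 < i \<Longrightarrow> i < length vs \<Longrightarrow> vs ! i \<noteq> A"
  using vs_Cons nth_eq_iff_index_eq[of vs i 0] by auto

text \<open>
  The list never turns back: if \<open>vs ! Suc i\<close> were at or to the left of \<open>vs ! i\<close>, then \<open>P\<close> would be
  squeezed between the lines through the two edges at \<open>vs ! i\<close>.
\<close>

lemma vs_fst_less: "Suc i < length vs \<Longrightarrow> fst (vs ! i) < fst (vs ! Suc i)"
proof (induction i)
  case 0
  then show ?case using vs_Cons vs_neq_A[of 1] vs_nth(2)[of 1] left by auto
next
  case (Suc i)
  define a b c where abc: "a = vs ! i" "b = vs ! Suc i" "c = vs ! Suc (Suc i)"
  have P: "a \<in> P" "b \<in> P" "c \<in> P" and bext: "b extreme_point_of P"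
    using vs_nth Suc.prems by (auto simp: abc)
  have ab: "fst a < fst b" using Suc by (simp add: abc)
  have bZ: "fst b < fst Z" using right[OF P(2)] vs_neq_Z[OF Suc.prems] by (simp add: abc)
  have bA: "fst A < fst b" using left[OF P(2)] vs_neq_A[of "Suc i"] Suc.prems by (simp add: abc)
  have cr1: "\<And>z. z \<in> P \<Longrightarrow> cross a b z \<ge> 0" and cr2: "\<And>z. z \<in> P \<Longrightarrow> cross b c z \<ge> 0" and bc: "b \<noteq> c"
    using vs_succ[of i] vs_succ[of "Suc i"] Suc.prems by (auto simp: ccw_succ_cross abc)
  show ?case
  proof (rule ccontr)
    assume "\<not> ?thesis"
    hence le: "fst c \<le> fst b" by (simp add: abc)
    \<comment> \<open>\<open>A\<close> is strictly left of \<open>b\<close> and \<open>Z\<close>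
      strictly right, so a vertical edge at \<open>b\<close> cannot have both on its left
      side.\<close>
    have A': "snd (c - b) * (fst b - fst A) \<ge> fst (b - c) * (snd A - snd b)"
      using cr2[OF A] by (simp add: cross_def algebra_simps)
    have Z': "fst (b - c) * (snd Z - snd b) \<le> - snd (c - b) * (fst Z - fst b)"
      using cr2[OF Z] by (simp add: cross_def algebra_simps)
    show False
    proof (cases "fst c = fst b")
      case True
      hence "snd (c - b) \<ge> 0" "snd (c - b) \<le> 0"
        using A' Z' bA bZ by (auto simp: zero_le_mult_iff mult_le_0_iff)
      with True bc show False by (simp add: prod_eq_iff)
    next
      case False
      \<comment> \<open>\<open>s\<close> and \<open>t\<close> are the slopes of the edges at
        \<open>b\<close>. As \<open>c\<close> lies to the left, \<open>P\<close> is above the first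
        line but below the second.\<close>
      define s where "s = (snd b - snd a) / (fst b - fst a)"
      define t where "t = (snd b - snd c) / (fst b - fst c)"
      have s: "snd b - snd a = s * (fst b - fst a)" using ab by (simp add: s_def)
      have t: "snd b - snd c = t * (fst b - fst c)" using False by (simp add: t_def)
      have d: "fst b - fst a > 0" "fst b - fst c > 0" using ab le False by auto
      have up: "snd z - snd b \<ge> s * (fst z - fst b)" if "z \<in> P" for z
      proof -
        have "(fst b - fst a) * (snd z - snd b - s * (fst z - fst b)) = cross a b z"
          using s by (simp add: cross_def) algebra
        with cr1[OF that] d(1) show ?thesis by (smt (verit) mult_pos_neg)
      qed
      have down: "snd z - snd b \<le> t * (fst z - fst b)" if "z \<in> P" for z
      proof -
        have "(fst b - fst c) * (t * (fst z - fst b) - (snd z - snd b)) = cross b c z"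
          using t by (simp add: cross_def) algebra
        with cr2[OF that] d(2) show ?thesis by (smt (verit) mult_pos_neg)
      qed
      \<comment> \<open>Comparing the bounds at \<open>Z\<close>, right of \<open>b\<close>, and at
        \<open>a\<close>, left of it, gives \<open>s = t\<close>. Hence \<open>Z\<close> is on the
        line through \<open>a\<close> and \<open>b\<close>, which puts \<open>b\<close> inside the
        segment from \<open>a\<close> to \<open>Z\<close>.\<close>
      have "s * (fst Z - fst b) \<le> t * (fst Z - fst b)" using up[OF Z] down[OF Z] by linarith
      hence st: "s \<le> t" using bZ by (simp add: mult_le_cancel_right)
      have "t * (fst a - fst b) \<ge> s * (fst a - fst b)" using up[OF P(1)] down[OF P(1)] by linarith
      hence "t = s" using st ab by (simp add: mult_le_cancel_right)
      hence Zl: "snd Z - snd b = s * (fst Z - fst b)" using up[OF Z] down[OF Z] by simp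
      define u where "u = (fst b - fst a) / (fst Z - fst a)"
      have u: "0 < u" "u < 1" "u * (fst Z - fst a) = fst b - fst a" using ab bZ by (auto simp: u_def)
      have "snd b = snd a + u * (snd Z - snd a)"
      proof -
        have "snd Z - snd a = s * (fst Z - fst a)" using Zl s by (simp add: algebra_simps)
        hence "u * (snd Z - snd a) = s * (fst b - fst a)" using u(3) by (metis mult.left_commute)
        with s show ?thesis by simp
      qed
      moreover have "fst b = fst a + u * (fst Z - fst a)" using u by simp
      ultimately have "b = (1 - u) *\<^sub>R a + u *\<^sub>R Z"
        by (simp add: prod_eq_iff algebra_simps)
      hence "b \<in> open_segment a Z"
        using u ab bZ by (auto simp: in_segment)
      with bext P(1) Z show False by (auto simp: extreme_point_of_def)
    qed
  qed
qed

text \<open>After the first edge the slope is at least \<open>l\<close> and the line of the edge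
  passes on or below \<open>A\<close>; followed back to abscissa 0 it ends below the origin. Index 0
  is excluded because the first edge may lie on a line through the origin.\<close>

lemma vs_cross_zero:
  assumes "0 < i" "Suc i < length vs"
  shows "cross (vs ! i) (vs ! Suc i) 0 > 0"
proof -
  define b c where bc: "b = vs ! i" "c = vs ! Suc i"
  have P: "b \<in> P" "c \<in> P" and bext: "b extreme_point_of P"
    using vs_nth assms by (auto simp: bc)
  have lt: "fst b < fst c" using vs_fst_less assms by (simp add: bc)
  have bA: "fst A < fst b" using left[OF P(1)] vs_neq_A[of i] assms by (simp add: bc)
  have crA: "cross b c A \<ge> 0"
    using vs_succ[of i] assms A by (auto simp: ccw_succ_cross bc)
  define s where "s = (snd c - snd b) / (fst c - fst b)"
  have s: "snd c - snd b = s * (fst c - fst b)" using lt by (simp add: s_def)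
  have "cross b c A = (fst c - fst b) * (snd A - snd b + s * (fst b - fst A))"
    unfolding cross_def fst_diff snd_diff s by (simp add: algebra_simps)
  hence 1: "snd A - snd b + s * (fst b - fst A) \<ge> 0"
    using crA lt by (simp add: zero_le_mult_iff)
  have "l * (fst b - fst A) \<le> snd b - snd A"
    using above[OF P(1)] snd_A by (simp add: algebra_simps)
  hence "l * (fst b - fst A) \<le> s * (fst b - fst A)" using 1 by linarith
  hence ls: "l \<le> s" using bA by simp
  \<comment> \<open>Both equalities together would put \<open>A\<close>, \<open>b\<close> and
    \<open>c\<close> on one line, with \<open>b\<close> between the other two.\<close>
  have "l \<noteq> s \<or> snd b \<noteq> l * fst b"
  proof (rule ccontr)
    assume "\<not> ?thesis"
    hence h: "s = l" "snd b = l * fst b" by auto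
    hence c: "snd c = l * fst c" using s by (simp add: algebra_simps)
    define u where "u = (fst b - fst A) / (fst c - fst A)"
    have u: "0 < u" "u < 1" "u * (fst c - fst A) = fst b - fst A"
      using lt bA by (auto simp: u_def)
    have "fst b = (1 - u) * fst A + u * fst c" using u by (simp add: algebra_simps)
    moreover from this have "l * fst b = l * ((1 - u) * fst A + u * fst c)" by simp
    hence "snd b = (1 - u) * snd A + u * snd c"
      unfolding h(2) c snd_A by (simp add: algebra_simps)
    ultimately have "b = (1 - u) *\<^sub>R A + u *\<^sub>R c"
      by (simp add: prod_eq_iff)
    hence "b \<in> open_segment A c"
      using u bA lt by (auto simp: in_segment)
    with bext A P show False by (auto simp: extreme_point_of_def)
  qed
  hence "snd b < s * fst b"
  proof
    assume "snd b \<noteq> l * fst b"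
    show ?thesis
    proof (rule ccontr)
      assume "\<not> ?thesis"
      with 1 have "s * fst A \<le> snd A" by (simp add: algebra_simps)
      hence "s * fst A \<le> l * fst A" using snd_A by simp
      hence "s = l" using ls fst_A_pos by simp
      with 1 snd_A above[OF P(1)] \<open>snd b \<noteq> l * fst b\<close> show False by (simp add: algebra_simps)
    qed
  next
    assume "l \<noteq> s"
    hence "l * fst A < s * fst A" using ls fst_A_pos by simp
    thus ?thesis using 1 snd_A by (simp add: algebra_simps)
  qed
  moreover have "cross b c 0 = (fst c - fst b) * (s * fst b - snd b)"
    unfolding cross_def fst_diff snd_diff s by (simp add: algebra_simps)
  ultimately show ?thesis using lt by (simp add: bc)
qed

text \<open>The outgoing edge supplies the supporting line; \<open>Z\<close> has none in the list
  and uses the vertical one.\<close>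

lemma vs_extreme_Q:
  assumes "0 < i" "i < length vs"
  shows "vs ! i extreme_point_of Q"
proof (cases "Suc i < length vs")
  case True
  show ?thesis
    by (rule extreme_point_cross[OF _ _ _ vs_cross_zero[OF assms(1) True]])
       (use vs_nth[of i] vs_succ[OF True] True in \<open>auto simp: ccw_succ_cross cross_def\<close>)
next
  case False
  hence "vs ! i = Z" using assms vs_Cons(1,4) by (metis Suc_lessI diff_Suc_1 last_conv_nth)
  thus ?thesis using extreme_point_Z by simp
qed

lemma vs_ccw_succ_Q: "0 < i \<Longrightarrow> Suc i < length vs \<Longrightarrow> ccw_succ Q (vs ! i) (vs ! Suc i)"
  using vs_succ[of i] vs_cross_zero[of i] vs_extreme_Q[of i] vs_extreme_Q[of "Suc i"]
  by (intro ccw_succ_Q) auto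

lemma zero_notin_P: "0 \<notin> P"
  using left'[of 0] fst_A_pos by auto

text \<open>
  The vertex list of \<open>Q\<close> is \<open>0 # vs\<close>, unless the first edge of \<open>P\<close> continues the segment from the
  origin to \<open>A\<close>; then \<open>A\<close> is no longer a vertex.
\<close>

lemma segment_subset_lower_boundary_Q:
  assumes i: "Suc i < length vs" and nseg: "\<nexists>a b. Q = closed_segment a b"
  shows "closed_segment (vs ! i) (vs ! Suc i) \<subseteq> lower_boundary Q"
proof -
  have lower: "closed_segment (ws ! j) (ws ! Suc j) \<subseteq> lower_boundary Q"
    if "lower_vertices Q ws" "Suc j < length ws" for ws j
    using that nseg unfolding lower_boundary_def by auto
  have tl: "tl vs \<noteq> []" "last (tl vs) = Z" "vs = A # tl vs"
    using i vs_Cons(1,3,4) by (cases vs; force)+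
  have nth_tl: "tl vs ! j = vs ! Suc j" if "Suc j < length vs" for j
    using that by (simp add: nth_tl)
  have notin: "0 \<notin> set vs"
    using vs zero_notin_P by (auto simp: lower_vertices_def extreme_point_of_def)
  have c: "vs ! 1 \<in> P" "fst A < fst (vs ! 1)"
    using vs_nth(2)[of 1] vs_fst_less[of 0] vs_Cons i by auto
  show ?thesis
  proof (cases "snd (vs ! 1) = l * fst (vs ! 1)")
    case False
    \<comment> \<open>The origin is strictly to the left of the first edge, so \<open>A\<close>
      remains a vertex.\<close>
    have "cross A (vs ! 1) 0 = fst A * (snd (vs ! 1) - l * fst (vs ! 1))"
      by (simp add: cross_def snd_A algebra_simps)
    also have "\<dots> > 0" using above[OF c(1)] False fst_A_pos by simp
    finally have cr: "cross A (vs ! 1) 0 > 0" .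
    have succ: "ccw_succ P A (vs ! 1)" using vs_succ[of 0] i vs_Cons by simp
    have Aext: "A extreme_point_of Q"
      by (rule extreme_point_cross[OF _ _ _ cr])
         (use succ in \<open>auto simp: ccw_succ_cross cross_def\<close>)
    have "ccw_succ Q A (vs ! 1)"
      using ccw_succ_Q[OF succ _ Aext] cr vs_extreme_Q[of 1] i by simp
    hence step: "ccw_succ Q (vs ! j) (vs ! Suc j)" if "Suc j < length vs" for j
      using vs_ccw_succ_Q[OF _ that] vs_Cons(5) by (cases "j = 0") auto
    have "lower_vertices Q (0 # vs)"
      unfolding lower_vertices_def
    proof (intro conjI allI impI subsetI ballI)
      fix x assume "x \<in> set (0 # vs)"
      moreover have "vs ! j extreme_point_of Q" if "j < length vs" for j
        using vs_extreme_Q[OF _ that] Aext vs_Cons(5) by (cases "j = 0") auto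
      ultimately show "x \<in> {u. u extreme_point_of Q}"
        using extreme_zero by (auto simp: in_set_conv_nth)
    next
      fix j assume "Suc j < length (0 # vs)"
      thus "ccw_succ Q ((0 # vs) ! j) ((0 # vs) ! Suc j)"
        using step ccw_succ_Q_zero[OF Aext fst_A_pos snd_A] vs_Cons(5) by (cases j) auto
    qed (use notin vs_Cons fst_Q_nonneg fst_Q_le in auto)
    from lower[OF this, of "Suc i"] i show ?thesis by simp
  next
    case True
    \<comment> \<open>Here \<open>A\<close> lies between the origin and \<open>vs ! 1\<close>, so
      the two collinear edges merge and \<open>A\<close> is dropped.\<close>
    have cext: "vs ! 1 extreme_point_of Q" using vs_extreme_Q[of 1] i by simp
    have zc: "ccw_succ Q 0 (vs ! 1)"
      using ccw_succ_Q_zero[OF cext _ True] c fst_A_pos by simp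
    have lv: "lower_vertices Q (0 # tl vs)"
      unfolding lower_vertices_def
    proof (intro conjI allI impI subsetI ballI)
      fix x assume "x \<in> set (0 # tl vs)"
      moreover have "tl vs ! j extreme_point_of Q" if "j < length (tl vs)" for j
        using vs_extreme_Q[of "Suc j"] that by (simp add: nth_tl)
      ultimately show "x \<in> {u. u extreme_point_of Q}"
        using extreme_zero by (auto simp: in_set_conv_nth)
    next
      fix j assume "Suc j < length (0 # tl vs)"
      thus "ccw_succ Q ((0 # tl vs) ! j) ((0 # tl vs) ! Suc j)"
        using vs_ccw_succ_Q[of j] zc by (cases j) (auto simp: nth_tl)
    next
      show "distinct (0 # tl vs)"
        using notin vs_Cons(2) tl(3) by (metis distinct.simps(2) list.set_intros(2))
    next
      fix z assume "z \<in> Q"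
      thus "fst (hd (0 # tl vs)) \<le> fst z" "fst z \<le> fst (last (0 # tl vs))"
        using fst_Q_nonneg fst_Q_le tl by auto
    qed simp
    show ?thesis
    proof (cases "i = 0")
      case False
      with lower[OF lv, of i] i show ?thesis by (cases i) (auto simp: nth_tl)
    next
      case i0: True
      \<comment> \<open>The ratio of abscissas locates \<open>A\<close> on the merged edge, which
        therefore contains the first edge of \<open>P\<close>.\<close>
      let ?u = "fst A / fst (vs ! 1)"
      have "A = (1 - ?u) *\<^sub>R 0 + ?u *\<^sub>R (vs ! 1)"
        using c fst_A_pos True snd_A by (simp add: prod_eq_iff)
      moreover have "0 \<le> ?u" "?u \<le> 1" using c fst_A_pos by auto
      ultimately have "A \<in> closed_segment 0 (vs ! 1)"
        unfolding in_segment by blast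
      hence "closed_segment A (vs ! 1) \<subseteq> closed_segment 0 (vs ! 1)"
        by (simp add: subset_closed_segment)
      also have "\<dots> \<subseteq> lower_boundary Q"
        using lower[OF lv, of 0] i by (simp add: nth_tl)
      finally show ?thesis using i0 vs_Cons(5) by simp
    qed
  qed
qed

end

lemma lower_boundary_subset: "lower_boundary P \<subseteq> lower_boundary Q"
proof -
  have sub: "lower_boundary P \<subseteq> P"
  proof -
    have "closed_segment (vs ! i) (vs ! Suc i) \<subseteq> P"
      if "lower_vertices P vs" "Suc i < length vs" for vs i
      using vs_nth(2)[OF that(1)] that(2) convex_P by (intro closed_segment_subset) auto
    thus ?thesis unfolding lower_boundary_def by auto
  qed
  show ?thesis
  proof (cases "\<exists>a b. Q = closed_segment a b")
    case True
    with sub P_subset_Q show ?thesis by (auto simp: lower_boundary_def)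
  next
    case nseg: False
    show ?thesis
    proof (cases "\<exists>a b. P = closed_segment a b")
      case False
      then show ?thesis
        using segment_subset_lower_boundary_Q[OF _ _ nseg]
        unfolding lower_boundary_def[of P] by (simp only: if_False) blast
    next
      case True
      \<comment> \<open>Now \<open>lower_boundary P\<close> is \<open>P\<close> by the segment
        clause. The list \<open>[A, Z]\<close> still satisfies \<open>lower_vertices\<close>, so the
        general vertex argument applies.\<close>
      then obtain a b where ab: "P = closed_segment a b" by blast
      have "A extreme_point_of P"
        by (rule extreme_point_of_unique_min[where h = fst]) (use A left left' in \<open>force simp: linear_fst\<close>)+
      moreover have "Z extreme_point_of P"
        by (rule extreme_point_of_unique_min[where h = "\<lambda>z. - fst z"])
           (use Z right right' in \<open>force simp: linear_compose_neg linear_fst\<close>)+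
      ultimately have AZ: "A extreme_point_of P" "Z extreme_point_of P" "A = a \<or> A = b" "Z = a \<or> Z = b"
        by (auto simp: ab extreme_point_of_segment)
      have "A \<noteq> Z"
      proof
        assume "A = Z"
        hence "z = A" if "z \<in> P" for z using left[OF that] right[OF that] by force
        hence "P = {A}" using A by blast
        hence "Q = closed_segment 0 A"
          unfolding Q_def by (simp add: segment_convex_hull)
        with nseg show False by blast
      qed
      with AZ ab have P: "P = closed_segment A Z" by (auto simp: closed_segment_commute)
      have "cross A Z z = 0" if "z \<in> P" for z
      proof -
        from that obtain u where "z = (1 - u) *\<^sub>R A + u *\<^sub>R Z"
          unfolding P in_segment by blast
        hence "z - A = u *\<^sub>R (Z - A)" by (simp add: algebra_simps)
        thus ?thesis unfolding cross_def by simp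
      qed
      hence "ccw_succ P A Z"
        using AZ \<open>A \<noteq> Z\<close> by (simp add: ccw_succ_cross)
      hence "lower_vertices P [A, Z]"
        using AZ \<open>A \<noteq> Z\<close> left' right' by (simp add: lower_vertices_def)
      from segment_subset_lower_boundary_Q[OF this, of 0] nseg
      have "closed_segment A Z \<subseteq> lower_boundary Q" by simp
      thus ?thesis using sub unfolding P[symmetric] by (rule order_trans[rotated])
    qed
  qed
qed

end

subsection \<open>Newton polygons of Belyi polynomials\<close>

lemma embedded_rat_closure_hom:
  assumes "embedded_rat_closure emb"
  shows "emb x = 0 \<longleftrightarrow> x = 0" and "emb (of_nat n) = of_nat n"
proof -
  interpret embedded_rat_closure emb by fact
  have 0: "emb 0 = 0"
    using emb_add[of 0 0] by simp
  thus "emb x = 0 \<longleftrightarrow> x = 0"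
    by (metis emb_mult emb_one mult_zero_left right_inverse zero_neq_one)
  show "emb (of_nat n) = of_nat n"
    by (induction n) (auto simp: 0 emb_add emb_one)
qed

text \<open>\<open>real_of_ereal\<close> sends infinity to 0, so the exponential alone would give
  zero the absolute value 1; hence the case distinction.\<close>

lemma valuation_nonarch_abs:
  assumes "padic_closure p Qp v" and "embedded_rat_closure emb"
  defines "u \<equiv> \<lambda>x. real_of_ereal (v (emb x))"
  shows "nonarch_abs (\<lambda>x. if x = 0 then 0 else exp (- u x))"
proof
  interpret padic_closure p Qp v by fact
  interpret embedded_rat_closure emb by fact
  note emb0 = embedded_rat_closure_hom(1)[OF assms(2)]
  have u: "v (emb x) = ereal (u x)" if "x \<noteq> 0" for x
    using that emb0[of x] v_not_MInf[of "emb x"] v_eq_PInf_iff[of "emb x"]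
    by (cases "v (emb x)") (auto simp: u_def)
  fix x y
  have "u (x * y) = u x + u y" if "x \<noteq> 0" "y \<noteq> 0"
    using v_mult[of "emb x" "emb y"] u[of x] u[of y] u[of "x * y"] that by (simp add: emb_mult)
  then show "(if x * y = 0 then 0 else exp (- u (x * y))) =
      (if x = 0 then 0 else exp (- u x)) * (if y = 0 then 0 else exp (- u y))"
    by (simp add: mult_exp_exp)
  have "min (u x) (u y) \<le> u (x + y)" if "x \<noteq> 0" "y \<noteq> 0" "x + y \<noteq> 0"
    using v_add[of "emb x" "emb y"] u[of x] u[of y] u[of "x + y"] that
    by (simp add: min_def emb_add split: if_splits)
  then show "(if x + y = 0 then 0 else exp (- u (x + y))) \<le>
      max (if x = 0 then 0 else exp (- u x)) (if y = 0 then 0 else exp (- u y))"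
    by (auto simp: max_def min_def split: if_splits)
qed auto

lemma valuation_of_nat:
  assumes "prime p" "padic_closure p Qp v" "embedded_rat_closure emb" "0 < i" "i < p"
  shows "v (emb (of_nat i)) = 0"
proof -
  interpret padic_closure p Qp v by fact
  have "\<not> p dvd i"
    using assms(4,5) by (auto dest: dvd_imp_le)
  hence "\<not> int p dvd int i" by simp
  \<comment> \<open>As an integer, \<open>i\<close> has denominator 1, and its numerator is prime to
    \<open>p\<close>.\<close>
  hence "rat_valuation p (of_int (int i)) = 0"
    using assms(4) by (simp add: rat_valuation_def quotient_of_int not_dvd_imp_multiplicity_0 zero_ereal_def
        del: of_int_of_nat_eq)
  thus ?thesis
    using v_of_rat[of "of_int (int i)"] embedded_rat_closure_hom(2)[OF assms(3)] by simp
qed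

section \<open>From Newton points to their convex hulls\<close>

lemma convex_insert_halfspace:
  fixes h :: "'a::real_vector \<Rightarrow> real"
  assumes "linear h"
  shows "convex (insert a {z. h a < h z})"
  unfolding convex_alt
proof (intro ballI allI impI)
  fix x y and u :: real
  assume x: "x \<in> insert a {z. h a < h z}" and y: "y \<in> insert a {z. h a < h z}"
    and u: "0 \<le> u \<and> u \<le> 1"
  have h: "h ((1 - u) *\<^sub>R x + u *\<^sub>R y) = h a + (1 - u) * (h x - h a) + u * (h y - h a)"
    unfolding linear_add[OF assms] linear_scale[OF assms] by (simp add: algebra_simps)
  consider "u = 0" | "u = 1" | "x = a" "y = a" | "0 < u" "u < 1" "h a < h x \<or> h a < h y"
    using x y u by force
  then show "(1 - u) *\<^sub>R x + u *\<^sub>R y \<in> insert a {z. h a < h z}"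
  proof cases
    case 4
    have "h a \<le> h x" "h a \<le> h y" using x y by auto
    with 4 have "(1 - u) * (h x - h a) + u * (h y - h a) > 0"
      by (auto intro: add_pos_nonneg add_nonneg_pos)
    thus ?thesis using h by simp
  qed (use x y in \<open>auto simp flip: scaleR_add_left\<close>)
qed

text \<open>Uniqueness of the minimiser passes from the generating points to the hull because an
  open half-space with one boundary point adjoined is convex.\<close>

lemma linear_min_convex_hull:
  fixes h :: "'a::real_vector \<Rightarrow> real"
  assumes "linear h" "\<And>z. z \<in> S \<Longrightarrow> z \<noteq> a \<Longrightarrow> h a < h z" "z \<in> convex hull S" "z \<noteq> a"
  shows "h a < h z"
proof -
  have "convex hull S \<subseteq> insert a {z. h a < h z}"
    using assms(2) by (intro hull_minimal convex_insert_halfspace assms(1)) auto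
  thus ?thesis using assms(3,4) by auto
qed

lemma lower_boundary_insert_zero:
  fixes c :: "nat \<Rightarrow> real" and l :: real
  assumes "m \<in> I" "n \<in> I" "0 < m" "\<And>i. i \<in> I \<Longrightarrow> m \<le> i \<and> i \<le> n"
    and "c m = l * m" "\<And>i. i \<in> I \<Longrightarrow> c i \<ge> l * i"
  defines "S \<equiv> (\<lambda>i. (real i, c i)) ` I"
  shows "lower_boundary (convex hull S) \<subseteq> lower_boundary (convex hull (insert 0 S))"
proof -
  have S: "real m < fst z" if "z \<in> S" "z \<noteq> (real m, c m)" for z
    using that assms(4) by (fastforce simp: S_def order_less_le)
  have S': "fst z < real n" if "z \<in> S" "z \<noteq> (real n, c n)" for z
    using that assms(4) by (fastforce simp: S_def order_less_le)
  have m: "real m < fst z" if "z \<in> convex hull S" "z \<noteq> (real m, c m)" for z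
    using linear_min_convex_hull[of fst S "(real m, c m)" z] S that by (simp add: linear_fst)
  have n: "fst z < real n" if "z \<in> convex hull S" "z \<noteq> (real n, c n)" for z
    using linear_min_convex_hull[of "\<lambda>z. - fst z" S "(real n, c n)" z] S' that
    by (simp add: linear_fst linear_compose_neg)
  have lin: "linear (\<lambda>z :: real \<times> real. snd z - l * fst z)"
    by (intro linearI) (auto simp: algebra_simps)
  have "convex {z :: real \<times> real. snd z - l * fst z \<ge> 0}"
    using convex_linear_vimage[OF lin, of "{0..}"] by (simp add: vimage_def)
  hence "convex hull S \<subseteq> {z. snd z - l * fst z \<ge> 0}"
    using assms(6) by (intro hull_minimal) (auto simp: S_def)
  then interpret cone_over "convex hull S" "(real m, c m)" "(real n, c n)" l
    using assms m n by unfold_locales (auto simp: S_def intro!: hull_inc)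
  show ?thesis
    using lower_boundary_subset by (simp add: Q_def hull_insert[symmetric])
qed

theorem theorem1:
  fixes p :: nat
    and Qp :: "'k::{alg_closed_field,field_char_0} set"
    and v :: "'k \<Rightarrow> ereal"
    and emb :: "'q::{alg_closed_field,field_char_0} \<Rightarrow> 'k"
    and B :: "'q poly"
  assumes "prime p"
    and "padic_closure p Qp v"
    and "embedded_rat_closure emb"
    and "belyi_poly B"
    and "degree B < p"
    and "poly B 0 = 0"
  shows "newton_polygon (\<lambda>a. v (emb a)) B \<subseteq> newton_polygon (\<lambda>a. v (emb a)) (B - 1)"
proof -
  define u where "u = (\<lambda>x. real_of_ereal (v (emb x)))"
  define N where "N = (\<lambda>x. if x = 0 then 0 else exp (- u x))"
  have nonarch: "nonarch_abs N"
    unfolding N_def u_def by (rule valuation_nonarch_abs[OF assms(2,3)])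
  then interpret nonarch_abs N .
  define I where "I = {i. coeff B i \<noteq> 0}"
  \<comment> \<open>The least slope of a line from the origin to a Newton point of
    \<open>B\<close>.\<close>
  define l where "l = Min ((\<lambda>i. u (coeff B i) / i) ` I)"
  define m where "m = order 0 B"
  have deg: "degree B > 0"
    using assms(4) by (simp add: belyi_poly_def)
  hence B: "B \<noteq> 0" by auto
  have I: "finite I" "degree B \<in> I" "i \<in> I \<Longrightarrow> i \<le> degree B" for i
    using B by (auto simp: I_def le_degree intro: finite_subset[of _ "{..degree B}"])
  have "0 \<notin> I"
    using assms(6) by (simp add: I_def poly_0_coeff_0)
  hence Ipos: "i > 0" if "i \<in> I" for i
    using that by (cases i) auto
  have l_le: "l * i \<le> u (coeff B i)" if "i \<in> I" for i
  proof -
    have "l \<le> u (coeff B i) / i"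
      unfolding l_def using I(1) that by (intro Min_le) auto
    thus ?thesis using Ipos[OF that] by (simp add: field_simps)
  qed
  have "l \<in> (\<lambda>i. u (coeff B i) / i) ` I"
    unfolding l_def using I by (intro Min_in) auto
  then obtain k where k: "k \<in> I" "l * k = u (coeff B k)"
    using Ipos by fastforce
  \<comment> \<open>At radius \<open>exp l\<close> the exponent is minus the height of the Newton
    point above the line of slope \<open>l\<close>.\<close>
  have N_coeff: "N (coeff B i) * exp l ^ i = exp (l * i - u (coeff B i))" if "i \<in> I" for i
    using that by (simp add: N_def I_def exp_of_nat2_mult exp_diff exp_minus divide_inverse)
  have "N (coeff B m) * exp l ^ m = 1"
    unfolding m_def
  proof (rule belyi_coeff_order_0[OF nonarch assms(4,6)])
    show "N (of_nat i) = 1" if "0 < i" "i \<le> degree B" for i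
      using that assms(5) valuation_of_nat[OF assms(1-3), of i] by (simp add: N_def u_def)
    show "N (coeff B i) * exp l ^ i \<le> 1" for i
      using N_coeff[of i] l_le[of i] by (cases "i \<in> I") (auto simp: I_def)
    show "\<exists>i>0. N (coeff B i) * exp l ^ i = 1"
      using N_coeff[of k] k Ipos by auto
  qed simp
  hence m: "m \<in> I" "u (coeff B m) = l * m"
  proof -
    show "m \<in> I" using \<open>N (coeff B m) * exp l ^ m = 1\<close> by (auto simp: I_def)
    from N_coeff[OF this] show "u (coeff B m) = l * m"
      using \<open>N (coeff B m) * exp l ^ m = 1\<close> by simp
  qed
  \<comment> \<open>x^m divides \<open>B\<close>, so all coefficients below \<open>m\<close>
    vanish.\<close>
  have m_le: "m \<le> i" if "i \<in> I" for i
    using that monom_1_dvd_iff[OF B, of m] monom_1_dvd_iff'[of m B]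
    by (auto simp: m_def I_def not_less[symmetric])
  define S where "S = (\<lambda>i. (real i, u (coeff B i))) ` I"
  \<comment> \<open>The zero constant term becomes -1, of valuation 0, which contributes the
    origin.\<close>
  have "coeff (B - 1) i = (if i = 0 then - 1 else coeff B i)" for i
    using \<open>0 \<notin> I\<close> by (auto simp: I_def)
  moreover have "u (- 1) = 0"
    using N_uminus[of 1] N_1 by (simp add: N_def)
  ultimately have "{(real i, u (coeff (B - 1) i)) |i. coeff (B - 1) i \<noteq> 0} = insert 0 S"
    using \<open>0 \<notin> I\<close> by (auto simp: S_def I_def zero_prod_def image_iff)
  hence "newton_hull (\<lambda>a. v (emb a)) (B - 1) = convex hull (insert 0 S)"
    by (simp add: newton_hull_def u_def)
  moreover have "newton_hull (\<lambda>a. v (emb a)) B = convex hull S"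
    by (simp add: newton_hull_def u_def S_def I_def setcompr_eq_image)
  moreover have "lower_boundary (convex hull S) \<subseteq> lower_boundary (convex hull (insert 0 S))"
    unfolding S_def using m m_le I l_le Ipos
    by (intro lower_boundary_insert_zero[where m = m and n = "degree B" and l = l]) auto
  ultimately show ?thesis
    by (simp add: newton_polygon_def)
qed

end
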